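(* Let $X$ be a finite set of cardinality $n$, let $N=\binom{n}{2}$, and let $\ast\in\mathcal{M}(X)$ be a binary operation with $drank(T_\ast)=d$, $crank(T_\ast)=c$, $arank(T_\ast)=a$. Then the cardinality of the $\mathcal{L}$-class of $\ast$ in $\mathcal{M}(X)$ is exactly $$\mathrm{Surj}(n,d)\sum_{r=a}^{N-c+d}\binom{N}{r}\,\mathrm{Surj}(r,a)\,2^r\left(c^{N-r}+\sum_{k=1}^{c-d}(-1)^k\binom{c-d}{k}(c-k)^{N-r}\right).$$
   Context: $\mathcal{M}(X)=X^{X\times X}$ is the set of all binary operations on $X$, a monoid under $\triangleright$ defined by $a(\circ\triangleright\ast)b=(a\circ b)\ast(b\circ a)$ for all $a,b\in X$, with identity $a\circ_{lz}b=a$. The left Green's relation $\mathcal{L}$: $\ast\,\mathcal{L}\,\star$ iff $\{\circ\triangleright\ast:\circ\in\mathcal{M}(X)\}=\{\circ\triangleright\star:\circ\in\mathcal{M}(X)\}$. The pairmorph transformation of $\ast$ is $T_\ast:X\times X\to X\times X$, $T_\ast(a,b)=(a\ast b,b\ast a)$. Let $\Delta(X)=\{(x,x):x\in X\}$, $im(T_\ast)=T_\ast(X\times X)$, $diag(T_\ast)=T_\ast(\Delta(X))$. Fix a tournament $\omega$ on $X$, i.e. a set $\omega\subseteq X\times X\setminus\Delta(X)$ containing exactly one of $(a,b),(b,a)$ for every pair of distinct $a,b\in X$ (so $|\omega|=N$). Let $acdom(T_\ast)=\{(a,b)\in X\times X: T_\ast(a,b)\notin\Delta(X)\}$, and let $accok_\ast: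 acdom(T_\ast)\cap\omega\to\omega$ be given by $accok_\ast(a,b)=T_\ast(a,b)$ if $T_\ast(a,b)\in\omega$, and $accok_\ast(a,b)=T_\ast(b,a)$ otherwise. Define the commutative image $cim(T_\ast)=im(T_\ast)\cap\Delta(X)$, the anticommutative image $acim(T_\ast)=im(accok_\ast)$, and $drank(T_\ast)=|diag(T_\ast)|$, $crank(T_\ast)=|cim(T_\ast)|$, $arank(T_\ast)=|acim(T_\ast)|$. $\mathrm{Surj}(m,k)$ denotes the number of surjective maps from an $m$-element set onto a $k$-element set, with $\mathrm{Surj}(0,0)=1$. *)

theory Defs
  imports "HOL-Library.FuncSet"
begin

text \<open>
  A binary operation on \<open>X\<close> is an element of \<open>X\<^bsup>X \<times> X\<^esup>\<close>, represented by an extensional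
  function on pairs, so that distinct HOL functions are distinct operations.
\<close>

definition binops :: "'a set \<Rightarrow> ('a \<times> 'a \<Rightarrow> 'a) set" where
  "binops X = (X \<times> X) \<rightarrow>\<^sub>E X"

definition tri :: "'a set \<Rightarrow> ('a \<times> 'a \<Rightarrow> 'a) \<Rightarrow> ('a \<times> 'a \<Rightarrow> 'a) \<Rightarrow> ('a \<times> 'a \<Rightarrow> 'a)" where
  "tri X f g = (\<lambda>(a, b)\<in>X \<times> X. g (f (a, b), f (b, a)))"

definition left_ideal :: "'a set \<Rightarrow> ('a \<times> 'a \<Rightarrow> 'a) \<Rightarrow> ('a \<times> 'a \<Rightarrow> 'a) set" where
  "left_ideal X g = {tri X f g | f. f \<in> binops X}"

definition green_L :: "'a set \<Rightarrow> (('a \<times> 'a \<Rightarrow> 'a) \<times> ('a \<times> 'a \<Rightarrow> 'a)) set" where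
  "green_L X = {(g, h). g \<in> binops X \<and> h \<in> binops X \<and> left_ideal X g = left_ideal X h}"

definition L_class :: "'a set \<Rightarrow> ('a \<times> 'a \<Rightarrow> 'a) \<Rightarrow> ('a \<times> 'a \<Rightarrow> 'a) set" where
  "L_class X g = green_L X `` {g}"

definition pairmorph :: "('a \<times> 'a \<Rightarrow> 'a) \<Rightarrow> 'a \<times> 'a \<Rightarrow> 'a \<times> 'a" where
  "pairmorph g = (\<lambda>(a, b). (g (a, b), g (b, a)))"

definition tournament :: "'a set \<Rightarrow> ('a \<times> 'a) set \<Rightarrow> bool" where
  "tournament X \<omega> \<longleftrightarrow> \<omega> \<subseteq> X \<times> X - Id_on X \<and>
     (\<forall>a\<in>X. \<forall>b\<in>X. a \<noteq> b \<longrightarrow> ((a, b) \<in> \<omega> \<longleftrightarrow> (b, a) \<notin> \<omega>))"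

definition im :: "'a set \<Rightarrow> ('a \<times> 'a \<Rightarrow> 'a) \<Rightarrow> ('a \<times> 'a) set" where
  "im X g = pairmorph g ` (X \<times> X)"

definition diag :: "'a set \<Rightarrow> ('a \<times> 'a \<Rightarrow> 'a) \<Rightarrow> ('a \<times> 'a) set" where
  "diag X g = pairmorph g ` Id_on X"

definition acdom :: "'a set \<Rightarrow> ('a \<times> 'a \<Rightarrow> 'a) \<Rightarrow> ('a \<times> 'a) set" where
  "acdom X g = {p \<in> X \<times> X. pairmorph g p \<notin> Id_on X}"

definition accok :: "('a \<times> 'a) set \<Rightarrow> ('a \<times> 'a \<Rightarrow> 'a) \<Rightarrow> 'a \<times> 'a \<Rightarrow> 'a \<times> 'a" where
  "accok \<omega> g = (\<lambda>(a, b).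
     if pairmorph g (a, b) \<in> \<omega> then pairmorph g (a, b) else pairmorph g (b, a))"

definition cim :: "'a set \<Rightarrow> ('a \<times> 'a \<Rightarrow> 'a) \<Rightarrow> ('a \<times> 'a) set" where
  "cim X g = im X g \<inter> Id_on X"

definition acim :: "'a set \<Rightarrow> ('a \<times> 'a) set \<Rightarrow> ('a \<times> 'a \<Rightarrow> 'a) \<Rightarrow> ('a \<times> 'a) set" where
  "acim X \<omega> g = accok \<omega> g ` (acdom X g \<inter> \<omega>)"

definition drank :: "'a set \<Rightarrow> ('a \<times> 'a \<Rightarrow> 'a) \<Rightarrow> nat" where
  "drank X g = card (diag X g)"

definition crank :: "'a set \<Rightarrow> ('a \<times> 'a \<Rightarrow> 'a) \<Rightarrow> nat" where
  "crank X g = card (cim X g)"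

definition arank :: "'a set \<Rightarrow> ('a \<times> 'a) set \<Rightarrow> ('a \<times> 'a \<Rightarrow> 'a) \<Rightarrow> nat" where
  "arank X \<omega> g = card (acim X \<omega> g)"

definition Surj :: "nat \<Rightarrow> nat \<Rightarrow> nat" where
  "Surj m k = card {f \<in> {..<m} \<rightarrow>\<^sub>E {..<k}. f ` {..<m} = {..<k}}"

lemma Surj_0_0: "Surj 0 0 = 1"
  by (simp add: Surj_def)

lemma accok_in_tournament:
  assumes "tournament X \<omega>" "g \<in> binops X" "p \<in> acdom X g \<inter> \<omega>"
  shows "accok \<omega> g p \<in> \<omega>"
proof -
  obtain a b where p: "p = (a, b)" by (cases p)
  have ab: "a \<in> X" "b \<in> X"
    using assms(3) p by (auto simp: acdom_def)
  have in_X: "g (a, b) \<in> X" "g (b, a) \<in> X"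
    using assms(2) ab unfolding binops_def by (blast intro: PiE_mem)+
  have "(g (a, b), g (b, a)) \<notin> Id_on X"
    using assms(3) by (simp add: p acdom_def pairmorph_def)
  with in_X have "g (a, b) \<noteq> g (b, a)"
    by (metis Id_onI)
  with assms(1) in_X have "(g (a, b), g (b, a)) \<in> \<omega> \<or> (g (b, a), g (a, b)) \<in> \<omega>"
    unfolding tournament_def by blast
  then show ?thesis
    by (auto simp: p accok_def pairmorph_def)
qed

end

theory Submission
  imports Defs
begin

text \<open>
  The pairmorph of \<open>tri X f g\<close> is the composite of the pairmorphs of \<open>f\<close> and \<open>g\<close>, and pairmorphs are
  exactly the self-maps of \<open>X \<times> X\<close> commuting with the swap.  Such a map is prescribed freely on
  the diagonal (with values on the diagonal) and on the tournament (with arbitrary values).  Hence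
  \<open>g\<close> factors through \<open>h\<close> iff \<open>diag\<close> and \<open>im\<close> of \<open>g\<close> are contained in those of \<open>h\<close>, and the
  \<open>\<L>\<close>-class of \<open>g\<close> consists of the operations with the same \<open>diag\<close> and \<open>im\<close>.  To count these, choose
  a surjection of \<open>X\<close> onto the diagonal image, the set \<open>R\<close> of the \<open>r\<close> tournament pairs with an
  off-diagonal value, a surjection of \<open>R\<close> onto the anticommutative image together with an orientation
  of each value, and a map from the remaining \<open>N - r\<close> pairs to the commutative image that hits
  every point outside the diagonal image; the last choice is counted by inclusion-exclusion.
\<close>

section \<open>Counting functions\<close>

text \<open>Bijections of both sets with initial segments of the naturals conjugate one set of
  surjections into the other, so \<open>Surj\<close> counts surjections between any finite
  sets.\<close>

lemma card_surjections:
  assumes "finite A" "finite B"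
  shows "card {f \<in> A \<rightarrow>\<^sub>E B. f ` A = B} = Surj (card A) (card B)"
proof -
  obtain p where p: "bij_betw p A {..<card A}"
    using finite_same_card_bij[OF assms(1), of "{..<card A}"] by auto
  obtain q where q: "bij_betw q B {..<card B}"
    using finite_same_card_bij[OF assms(2), of "{..<card B}"] by auto
  define p' where "p' = the_inv_into A p"
  define q' where "q' = the_inv_into B q"
  have p': "bij_betw p' {..<card A} A" unfolding p'_def using p by (rule bij_betw_the_inv_into)
  have q': "bij_betw q' {..<card B} B" unfolding q'_def using q by (rule bij_betw_the_inv_into)
  have pp [simp]: "\<And>x. x \<in> A \<Longrightarrow> p' (p x) = x" "\<And>i. i < card A \<Longrightarrow> p (p' i) = i"
    and qq [simp]: "\<And>y. y \<in> B \<Longrightarrow> q' (q y) = y" "\<And>j. j < card B \<Longrightarrow> q (q' j) = j"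
    using p q unfolding p'_def q'_def
    by (auto simp: the_inv_into_f_f f_the_inv_into_f_bij_betw bij_betw_def)
  note im = bij_betw_imp_surj_on[OF p] bij_betw_imp_surj_on[OF q]
    bij_betw_imp_surj_on[OF p'] bij_betw_imp_surj_on[OF q']
  have mem: "\<And>x. x \<in> A \<Longrightarrow> p x < card A" "\<And>y. y \<in> B \<Longrightarrow> q y < card B"
    "\<And>i. i < card A \<Longrightarrow> p' i \<in> A" "\<And>j. j < card B \<Longrightarrow> q' j \<in> B"
    using im by auto
  let ?F = "\<lambda>f. \<lambda>i\<in>{..<card A}. q (f (p' i))"
  let ?G = "\<lambda>h. \<lambda>x\<in>A. q' (h (p x))"
  have F_im: "?F f ` {..<card A} = q ` f ` A" for f
  proof -
    have "q ` f ` A = q ` f ` p' ` {..<card A}" unfolding im(3) ..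
    then show ?thesis by (simp add: image_image)
  qed
  have G_im: "?G h ` A = q' ` h ` {..<card A}" for h
  proof -
    have "q' ` h ` {..<card A} = q' ` h ` p ` A" unfolding im(1) ..
    then show ?thesis by (simp add: image_image)
  qed
  have "bij_betw ?F {f \<in> A \<rightarrow>\<^sub>E B. f ` A = B}
      {f \<in> {..<card A} \<rightarrow>\<^sub>E {..<card B}. f ` {..<card A} = {..<card B}}"
  proof (rule bij_betw_byWitness[where f' = ?G]; intro ballI image_subsetI)
    fix f assume "f \<in> {f \<in> A \<rightarrow>\<^sub>E B. f ` A = B}"
    then have f: "f \<in> A \<rightarrow>\<^sub>E B" "f ` A = B" by blast+
    have fB: "f x \<in> B" if "x \<in> A" for x using f(1) that by (rule PiE_mem)
    show "?G (?F f) = f"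
      by (rule PiE_ext[of _ A "\<lambda>_. B"]) (use f(1) fB mem in simp_all)
    show "?F f \<in> {f \<in> {..<card A} \<rightarrow>\<^sub>E {..<card B}. f ` {..<card A} = {..<card B}}"
      using F_im[of f] fB mem f(2) im(2) by simp
  next
    fix h assume "h \<in> {f \<in> {..<card A} \<rightarrow>\<^sub>E {..<card B}. f ` {..<card A} = {..<card B}}"
    then have h: "h \<in> {..<card A} \<rightarrow>\<^sub>E {..<card B}" "h ` {..<card A} = {..<card B}" by blast+
    have hB: "h i < card B" if "i < card A" for i using PiE_mem[OF h(1), of i] that by simp
    show "?F (?G h) = h"
      by (rule PiE_ext[of _ "{..<card A}" "\<lambda>_. {..<card B}"]) (use h(1) hB mem in simp_all)
    show "?G h \<in> {f \<in> A \<rightarrow>\<^sub>E B. f ` A = B}"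
      using G_im[of h] hB mem h(2) im(4) by simp
  qed
  then show ?thesis unfolding Surj_def by (rule bij_betw_same_card)
qed

lemma Surj_eq_0:
  assumes "m < k"
  shows "Surj m k = 0"
proof -
  have "f ` {..<m} \<noteq> {..<k}" for f :: "nat \<Rightarrow> nat"
    using card_image_le[of "{..<m}" f] assms by auto
  then show ?thesis by (simp add: Surj_def)
qed

text \<open>Arithmetic form of deleting one point from the codomain: with \<open>x\<close> the size
  of the codomain, this is the recursion that drives inclusion-exclusion below.\<close>

lemma alternating_binomial_sum_Suc:
  fixes x :: int
  shows "(\<Sum>k\<le>Suc m. (- 1) ^ k * int (Suc m choose k) * (x - int k) ^ M) =
    (\<Sum>k\<le>m. (- 1) ^ k * int (m choose k) * (x - int k) ^ M) -
    (\<Sum>k\<le>m. (- 1) ^ k * int (m choose k) * (x - 1 - int k) ^ M)"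
proof -
  let ?t = "\<lambda>k. (- 1) ^ k * int (m choose k) * (x - int k) ^ M"
  \<comment> \<open>Pascal's rule; the index shift supplies the minus sign and rewrites
    \<open>x - (k + 1)\<close> as \<open>(x - 1) - k\<close>.\<close>
  have "(- 1) ^ Suc k * int (Suc m choose Suc k) * (x - int (Suc k)) ^ M =
      ?t (Suc k) - (- 1) ^ k * int (m choose k) * (x - 1 - int k) ^ M" for k
    by (simp add: algebra_simps)
  then have "(\<Sum>k\<le>Suc m. (- 1) ^ k * int (Suc m choose k) * (x - int k) ^ M) =
      x ^ M + (\<Sum>k\<le>m. ?t (Suc k) - (- 1) ^ k * int (m choose k) * (x - 1 - int k) ^ M)"
    unfolding sum.atMost_Suc_shift by simp
  also have "\<dots> = (\<Sum>k\<le>Suc m. ?t k) -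
      (\<Sum>k\<le>m. (- 1) ^ k * int (m choose k) * (x - 1 - int k) ^ M)"
    unfolding sum.atMost_Suc_shift[of ?t] sum_subtractf by simp
  \<comment> \<open>The top term vanishes because \<open>m choose Suc m\<close> is 0.\<close>
  also have "(\<Sum>k\<le>Suc m. ?t k) = (\<Sum>k\<le>m. ?t k)" by simp
  finally show ?thesis .
qed

text \<open>Inclusion-exclusion by induction on \<open>S\<close>: a map covering \<open>S\<close>
  either hits the new point \<open>s\<close> or is a map into \<open>C - {s}\<close>. The codomain
  shrinks in the second case, so \<open>C\<close> is generalized.\<close>

lemma card_functions_covering:
  assumes "finite A" "finite C" "S \<subseteq> C"
  shows "int (card {f \<in> A \<rightarrow>\<^sub>E C. S \<subseteq> f ` A}) =
    (\<Sum>k\<le>card S. (- 1) ^ k * int (card S choose k) * (int (card C) - int k) ^ card A)"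
proof -
  have "finite S" using assms finite_subset by blast
  then show ?thesis using assms(2,3)
  proof (induction S arbitrary: C)
    case empty
    then show ?case using assms(1) by (simp add: card_PiE)
  next
    case (insert s S)
    let ?F = "\<lambda>S C. {f \<in> A \<rightarrow>\<^sub>E C. S \<subseteq> f ` A}"
    have fin: "finite (?F S C)" for S
      using insert.prems assms(1) by (simp add: finite_PiE)
    have "?F S C = ?F (insert s S) C \<union> ?F S (C - {s})"
      by (auto simp: PiE_iff)
    moreover have "?F (insert s S) C \<inter> ?F S (C - {s}) = {}" by (auto simp: PiE_iff)
    ultimately have "card (?F S C) = card (?F (insert s S) C) + card (?F S (C - {s}))"
      using fin by (metis (no_types, lifting) card_Un_disjoint finite_Un)
    moreover have "int (card (C - {s})) = int (card C) - 1"
      using insert.prems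
      by (metis card_Suc_Diff1 insert_subset of_nat_Suc add_diff_cancel_left')
    moreover have "S \<subseteq> C - {s}" "S \<subseteq> C" using insert by auto
    ultimately show ?case
      using insert.IH[of C] insert.IH[of "C - {s}"] insert.prems(1) insert.hyps
      by (simp add: alternating_binomial_sum_Suc del: sum.atMost_Suc binomial_Suc_Suc)
  qed
qed

text \<open>The sum counts maps from \<open>M\<close> points into \<open>c\<close> points that cover
  \<open>m\<close> prescribed ones, and there are none when \<open>M < m\<close>. This will bound
  \<open>r\<close> from above.\<close>

lemma alternating_binomial_sum_eq_0:
  assumes "M < m" "m \<le> c"
  shows "(\<Sum>k\<le>m. (- 1) ^ k * int (m choose k) * (int c - int k) ^ M) = 0"
proof -
  have "\<not> {..<m} \<subseteq> f ` {..<M}" for f :: "nat \<Rightarrow> nat"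
    using card_image_le[of "{..<M}" f] card_mono[of "f ` {..<M}" "{..<m}"] assms(1) by auto
  then show ?thesis
    using card_functions_covering[of "{..<M}" "{..<c}" "{..<m}"] assms(2) by simp
qed

text \<open>Grouping subsets by size produces the factor \<open>N choose r\<close> of the final
  formula.\<close>

lemma sum_Pow_card:
  fixes \<phi> :: "nat \<Rightarrow> int"
  assumes "finite S"
  shows "(\<Sum>R\<in>Pow S. \<phi> (card R)) = (\<Sum>r\<le>card S. int (card S choose r) * \<phi> r)"
proof -
  have "(\<Sum>R\<in>Pow S. \<phi> (card R)) = (\<Sum>r\<le>card S. \<Sum>R | R \<in> Pow S \<and> card R = r. \<phi> (card R))"
    using assms by (subst sum.group) (auto intro: card_mono)
  also have "\<dots> = (\<Sum>r\<le>card S. int (card S choose r) * \<phi> r)"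
    using assms by (intro sum.cong) (auto simp: n_subsets)
  finally show ?thesis .
qed

section \<open>Operations prescribed on the diagonal and on a tournament\<close>

lemma pairmorph_simp [simp]: "pairmorph g (a, b) = (g (a, b), g (b, a))"
  by (simp add: pairmorph_def)

lemma pairmorph_swap: "pairmorph g (prod.swap p) = prod.swap (pairmorph g p)"
  by (cases p) simp

lemma binops_mem: "g \<in> binops X \<Longrightarrow> a \<in> X \<Longrightarrow> b \<in> X \<Longrightarrow> g (a, b) \<in> X"
  unfolding binops_def by (blast intro: PiE_mem)

lemma pairmorph_mem: "g \<in> binops X \<Longrightarrow> p \<in> X \<times> X \<Longrightarrow> pairmorph g p \<in> X \<times> X"
  by (auto simp: binops_mem)

lemma tournamentD:
  assumes "tournament X \<omega>" "(a, b) \<in> \<omega>"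
  shows "a \<in> X" "b \<in> X" "a \<noteq> b" "(b, a) \<notin> \<omega>"
proof -
  show "a \<in> X" "b \<in> X" "a \<noteq> b" using assms by (auto simp: tournament_def)
  then show "(b, a) \<notin> \<omega>" using assms unfolding tournament_def by blast
qed

lemma tournament_subset: "tournament X \<omega> \<Longrightarrow> \<omega> \<subseteq> X \<times> X"
  by (auto simp: tournament_def)

lemma tournament_total:
  assumes "tournament X \<omega>" "a \<in> X" "b \<in> X" "a \<noteq> b"
  shows "(a, b) \<in> \<omega> \<or> (b, a) \<in> \<omega>"
  using assms unfolding tournament_def by blast

lemma tournament_cover:
  assumes "tournament X \<omega>"
  shows "X \<times> X = Id_on X \<union> \<omega> \<union> prod.swap ` \<omega>"
  using assms by (force simp: tournament_def image_iff)

text \<open>The square is the disjoint union of the diagonal, \<omega> and the swapped copy of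
  \<omega>, so n^2 = n + 2 |\<omega>|.\<close>

lemma card_tournament:
  assumes "finite X" "tournament X \<omega>"
  shows "card \<omega> = card X choose 2"
proof -
  have fin: "finite \<omega>" using assms tournament_subset finite_subset by blast
  have disj: "Id_on X \<inter> \<omega> = {}" "(Id_on X \<union> \<omega>) \<inter> prod.swap ` \<omega> = {}"
    by (auto dest: tournamentD[OF assms(2)])
  have "Id_on X = (\<lambda>x. (x, x)) ` X" by auto
  then have Id: "card (Id_on X) = card X" "finite (Id_on X)"
    using assms(1) by (auto simp: card_image inj_on_def)
  have "card X * card X = card (Id_on X \<union> \<omega> \<union> prod.swap ` \<omega>)"
    unfolding tournament_cover[OF assms(2), symmetric] by (simp add: card_cartesian_product)
  also have "\<dots> = card X + card \<omega> + card \<omega>"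
    using fin Id disj by (simp add: card_Un_disjoint card_image)
  finally have "2 * card \<omega> = card X * (card X - 1)" by (simp add: diff_mult_distrib2)
  then show ?thesis by (simp add: choose_two)
qed

text \<open>Inverse to restricting a pairmorph to the diagonal and to \<omega>. On swapped pairs the
  value is forced by equivariance, hence the second component of \<open>v (b, a)\<close>.\<close>

definition glue :: "'a set \<Rightarrow> ('a \<times> 'a) set \<Rightarrow> ('a \<Rightarrow> 'a) \<Rightarrow> ('a \<times> 'a \<Rightarrow> 'a \<times> 'a) \<Rightarrow> 'a \<times> 'a \<Rightarrow> 'a" where
  "glue X \<omega> u v = (\<lambda>(a, b)\<in>X \<times> X.
     if a = b then u a else if (a, b) \<in> \<omega> then fst (v (a, b)) else snd (v (b, a)))"

lemma glue_diagonal: "x \<in> X \<Longrightarrow> glue X \<omega> u v (x, x) = u x"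
  by (simp add: glue_def)

lemma pairmorph_glue:
  assumes "tournament X \<omega>" "p \<in> \<omega>"
  shows "pairmorph (glue X \<omega> u v) p = v p"
proof -
  obtain a b where p: "p = (a, b)" by (cases p)
  then have "a \<in> X" "b \<in> X" "a \<noteq> b" "(b, a) \<notin> \<omega>"
    using assms tournamentD by metis+
  then show ?thesis using assms(2) p by (auto simp: glue_def)
qed

lemma glue_in_binops:
  assumes "tournament X \<omega>" "u \<in> X \<rightarrow> X" "v \<in> \<omega> \<rightarrow> X \<times> X"
  shows "glue X \<omega> u v \<in> binops X"
proof -
  have v: "fst (v p) \<in> X" "snd (v p) \<in> X" if "p \<in> \<omega>" for p
    using assms(3) that by (auto simp: Pi_iff mem_Times_iff)
  \<comment> \<open>Off the diagonal and off \<omega> the swapped pair lies in \<omega>, where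
    \<open>v\<close> is controlled.\<close>
  have "snd (v (b, a)) \<in> X" if "a \<in> X" "b \<in> X" "a \<noteq> b" "(a, b) \<notin> \<omega>" for a b
    using v(2) tournament_total[OF assms(1) that(1-3)] that(4) by blast
  then show ?thesis
    using assms(2) v(1) by (auto simp: binops_def glue_def Pi_iff)
qed

text \<open>If \<open>(b, a)\<close> is in \<omega>, the value at \<open>(a, b)\<close> is the
  second component of the pairmorph at \<open>(b, a)\<close>, so the swapped half carries no further
  information.\<close>

lemma binops_eqI:
  assumes "tournament X \<omega>" "g \<in> binops X" "h \<in> binops X"
    and "\<And>x. x \<in> X \<Longrightarrow> g (x, x) = h (x, x)"
    and "\<And>p. p \<in> \<omega> \<Longrightarrow> pairmorph g p = pairmorph h p"
  shows "g = h"
proof (rule PiE_ext)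
  show "g \<in> X \<times> X \<rightarrow>\<^sub>E X" "h \<in> X \<times> X \<rightarrow>\<^sub>E X" using assms by (auto simp: binops_def)
  fix p assume "p \<in> X \<times> X"
  then obtain a b where p: "p = (a, b)" "a \<in> X" "b \<in> X" by auto
  then consider "a = b" | "(a, b) \<in> \<omega>" | "(b, a) \<in> \<omega>"
    using tournament_total[OF assms(1)] by blast
  then show "g p = h p" using assms(4) assms(5)[of "(a, b)"] assms(5)[of "(b, a)"] p
    by cases auto
qed

section \<open>Diagonal and image of a pairmorph\<close>

lemma diag_eq: "diag X g = (\<lambda>x. (x, x)) ` (\<lambda>x. g (x, x)) ` X"
  by (auto simp: diag_def image_iff Id_on_def)

lemma im_eq:
  assumes "tournament X \<omega>"
  shows "im X g = diag X g \<union> pairmorph g ` \<omega> \<union> prod.swap ` pairmorph g ` \<omega>"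
proof -
  have "pairmorph g ` prod.swap ` \<omega> = prod.swap ` pairmorph g ` \<omega>"
    by (simp add: image_image pairmorph_swap)
  then show ?thesis
    unfolding im_def diag_def by (subst tournament_cover[OF assms]) (simp add: image_Un)
qed

lemma diag_subset: "g \<in> binops X \<Longrightarrow> diag X g \<subseteq> Id_on X"
  by (auto simp: diag_eq binops_mem)

lemma im_subset: "g \<in> binops X \<Longrightarrow> im X g \<subseteq> X \<times> X"
  unfolding im_def using pairmorph_mem by blast

lemma im_swap: "p \<in> im X g \<Longrightarrow> prod.swap p \<in> im X g"
  unfolding im_def by (auto simp del: pairmorph_simp simp flip: pairmorph_swap)

section \<open>The left Green classes\<close>

lemma tri_in_binops:
  assumes "f \<in> binops X" "g \<in> binops X"
  shows "tri X f g \<in> binops X"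
  unfolding tri_def binops_def restrict_PiE_iff using assms by (auto simp: binops_mem)

lemma pairmorph_tri: "p \<in> X \<times> X \<Longrightarrow> pairmorph (tri X f g) p = pairmorph g (pairmorph f p)"
  by (auto simp: tri_def)

lemma left_ideal_self:
  assumes "g \<in> binops X"
  shows "g \<in> left_ideal X g"
proof -
  \<comment> \<open>The left-zero operation is the identity of the monoid: its pairmorph fixes every
    pair.\<close>
  let ?lz = "\<lambda>(a, b)\<in>X \<times> X. a"
  have "?lz \<in> binops X" by (auto simp: binops_def)
  moreover have "tri X ?lz g = g"
    using assms by (auto simp: tri_def binops_def fun_eq_iff PiE_iff extensional_def)
  ultimately show ?thesis unfolding left_ideal_def by force
qed

lemma tri_assoc: "f \<in> binops X \<Longrightarrow> tri X f (tri X g h) = tri X (tri X f g) h"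
  by (auto simp: tri_def fun_eq_iff binops_mem)

text \<open>The usual monoid argument: the identity gives one direction, associativity the
  other.\<close>

lemma left_ideal_subset_iff:
  assumes "g \<in> binops X" "h \<in> binops X"
  shows "left_ideal X g \<subseteq> left_ideal X h \<longleftrightarrow> g \<in> left_ideal X h"
proof
  show "left_ideal X g \<subseteq> left_ideal X h \<Longrightarrow> g \<in> left_ideal X h"
    using left_ideal_self[OF assms(1)] by blast
  assume "g \<in> left_ideal X h"
  then obtain f where f: "f \<in> binops X" "g = tri X f h" by (auto simp: left_ideal_def)
  then show "left_ideal X g \<subseteq> left_ideal X h"
    unfolding left_ideal_def using tri_assoc tri_in_binops by blast
qed

lemma in_left_ideal_iff:
  assumes \<omega>: "tournament X \<omega>" and g: "g \<in> binops X" and h: "h \<in> binops X"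
  shows "g \<in> left_ideal X h \<longleftrightarrow> diag X g \<subseteq> diag X h \<and> im X g \<subseteq> im X h"
proof
  assume "g \<in> left_ideal X h"
  then obtain f where f: "f \<in> binops X" "g = tri X f h" by (auto simp: left_ideal_def)
  have "diag X g \<subseteq> diag X h"
    using f by (auto simp: diag_eq tri_def binops_mem)
  moreover have "im X g \<subseteq> im X h"
    unfolding im_def
  proof (rule image_subsetI)
    fix p assume p: "p \<in> X \<times> X"
    show "pairmorph g p \<in> pairmorph h ` (X \<times> X)"
      unfolding f(2) pairmorph_tri[OF p] using pairmorph_mem[OF f(1) p] by (rule imageI)
  qed
  ultimately show "diag X g \<subseteq> diag X h \<and> im X g \<subseteq> im X h" ..
next
  assume asm: "diag X g \<subseteq> diag X h \<and> im X g \<subseteq> im X h"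
  \<comment> \<open>The factor \<open>f\<close> must send the diagonal to itself; inclusion of the
    \<open>diag\<close> sets provides preimages there.\<close>
  have "\<forall>x\<in>X. \<exists>y\<in>X. h (y, y) = g (x, x)"
    using asm by (fastforce simp: diag_eq)
  then obtain u where u: "\<And>x. x \<in> X \<Longrightarrow> u x \<in> X \<and> h (u x, u x) = g (x, x)"
    by metis
  \<comment> \<open>On \<omega> any preimage in the square will do, and gluing makes the choice
    equivariant.\<close>
  have "\<forall>p\<in>\<omega>. \<exists>q\<in>X \<times> X. pairmorph h q = pairmorph g p"
  proof
    fix p assume "p \<in> \<omega>"
    then have "pairmorph g p \<in> im X h"
      using asm tournament_subset[OF \<omega>] unfolding im_def by blast
    then show "\<exists>q\<in>X \<times> X. pairmorph h q = pairmorph g p" unfolding im_def by force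
  qed
  then obtain v where v: "\<And>p. p \<in> \<omega> \<Longrightarrow> v p \<in> X \<times> X \<and> pairmorph h (v p) = pairmorph g p"
    by metis
  let ?f = "glue X \<omega> u v"
  have f: "?f \<in> binops X" using u v by (intro glue_in_binops[OF \<omega>]) auto
  have "g = tri X ?f h"
  proof (rule binops_eqI[OF \<omega> g tri_in_binops[OF f h]])
    show "g (x, x) = tri X ?f h (x, x)" if "x \<in> X" for x
      using u that by (simp add: tri_def glue_diagonal)
    show "pairmorph g p = pairmorph (tri X ?f h) p" if "p \<in> \<omega>" for p
      using v[OF that] that tournament_subset[OF \<omega>] pairmorph_tri[of p X ?f h]
        pairmorph_glue[OF \<omega> that] by auto
  qed
  then show "g \<in> left_ideal X h" unfolding left_ideal_def using f by blast
qed

lemma L_class_eq: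
  assumes "tournament X \<omega>" "g \<in> binops X"
  shows "L_class X g = {h \<in> binops X. diag X h = diag X g \<and> im X h = im X g}"
proof -
  have sub: "left_ideal X f \<subseteq> left_ideal X h \<longleftrightarrow> diag X f \<subseteq> diag X h \<and> im X f \<subseteq> im X h"
    if "f \<in> binops X" "h \<in> binops X" for f h
    unfolding left_ideal_subset_iff[OF that] in_left_ideal_iff[OF assms(1) that] ..
  have "left_ideal X g = left_ideal X h \<longleftrightarrow> diag X h = diag X g \<and> im X h = im X g"
    if "h \<in> binops X" for h
    unfolding set_eq_subset sub[OF assms(2) that] sub[OF that assms(2)] by auto
  then show ?thesis using assms(2) by (auto simp: L_class_def green_L_def)
qed

section \<open>Counting operations with given diagonal and image\<close>

text \<open>Chooses the representative in \<omega> of an unordered pair of distinct points;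
  \<open>accok\<close> is \<open>orient\<close> after \<open>pairmorph\<close>.\<close>

definition orient :: "('a \<times> 'a) set \<Rightarrow> 'a \<times> 'a \<Rightarrow> 'a \<times> 'a" where
  "orient \<omega> p = (if p \<in> \<omega> then p else prod.swap p)"

lemma orient_mem:
  assumes "tournament X \<omega>" "p \<in> X \<times> X" "p \<notin> Id_on X"
  shows "orient \<omega> p \<in> \<omega>"
  using assms tournament_total[OF assms(1), of "fst p" "snd p"]
  by (cases p) (auto simp: orient_def Id_on_iff)

lemma swap_notin_tournament: "tournament X \<omega> \<Longrightarrow> p \<in> \<omega> \<Longrightarrow> prod.swap p \<notin> \<omega>"
  by (cases p) (auto dest: tournamentD(4))

text \<open>Since \<omega> avoids the diagonal, an image point in \<omega> is a value on \<omega> or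
  the swap of one; conversely, the image is closed under swap.\<close>

lemma im_Int_tournament:
  assumes "tournament X \<omega>" "g \<in> binops X"
  shows "im X g \<inter> \<omega> = orient \<omega> ` (pairmorph g ` \<omega> - Id_on X)"
proof
  show "orient \<omega> ` (pairmorph g ` \<omega> - Id_on X) \<subseteq> im X g \<inter> \<omega>"
  proof (intro image_subsetI IntI)
    fix q assume q: "q \<in> pairmorph g ` \<omega> - Id_on X"
    then have "q \<in> im X g" using im_eq[OF assms(1)] by auto
    then show "orient \<omega> q \<in> im X g" using im_swap[of q X g] by (simp add: orient_def)
    show "orient \<omega> q \<in> \<omega>"
      using q \<open>q \<in> im X g\<close> im_subset[OF assms(2)] orient_mem[OF assms(1)] by blast
  qed
  show "im X g \<inter> \<omega> \<subseteq> orient \<omega> ` (pairmorph g ` \<omega> - Id_on X)"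
  proof
    fix q assume q: "q \<in> im X g \<inter> \<omega>"
    have nId: "q \<notin> Id_on X" "prod.swap q \<notin> Id_on X"
      using q assms(1) by (auto simp: tournament_def)
    then have "q \<notin> diag X g" using diag_subset[OF assms(2)] by blast
    then have "q \<in> pairmorph g ` \<omega> \<or> q \<in> prod.swap ` pairmorph g ` \<omega>"
      using q im_eq[OF assms(1), of g] by blast
    then consider "q \<in> pairmorph g ` \<omega>" | "prod.swap q \<in> pairmorph g ` \<omega>"
      by (metis imageE swap_swap)
    then show "q \<in> orient \<omega> ` (pairmorph g ` \<omega> - Id_on X)"
    proof cases
      case 1
      then show ?thesis using q nId by (intro image_eqI[of _ _ q]) (auto simp: orient_def)
    next
      case 2
      then show ?thesis using q nId swap_notin_tournament[OF assms(1)]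
        by (intro image_eqI[of _ _ "prod.swap q"]) (auto simp: orient_def)
    qed
  qed
qed

text \<open>Here and in \<open>image_Int_eq\<close> the set
  \<open>{p \<in> S. f p \<notin> B}\<close> is kept explicit, so that the locus of off-diagonal
  values can be rewritten as a named set.\<close>

lemma image_Diff_eq: "f ` S - B = f ` {p \<in> S. f p \<notin> B}"
  by blast

lemma image_Int_eq: "f ` S \<inter> B = f ` (S - {p \<in> S. f p \<notin> B})"
  by blast

text \<open>Restricting to \<open>acdom\<close> discards exactly the diagonal values, so
  \<open>acim\<close> depends on the operation only through its image.\<close>

lemma acim_eq:
  assumes "tournament X \<omega>" "g \<in> binops X"
  shows "acim X \<omega> g = im X g \<inter> \<omega>"
proof -
  have "accok \<omega> g p = orient \<omega> (pairmorph g p)" for p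
    by (cases p) (simp add: accok_def orient_def)
  moreover have "acdom X g \<inter> \<omega> = {p \<in> \<omega>. pairmorph g p \<notin> Id_on X}"
    using subsetD[OF tournament_subset[OF assms(1)]]
    by (auto simp: acdom_def simp del: pairmorph_simp)
  then have "pairmorph g ` (acdom X g \<inter> \<omega>) = pairmorph g ` \<omega> - Id_on X"
    unfolding image_Diff_eq by (rule arg_cong)
  ultimately show ?thesis
    unfolding im_Int_tournament[OF assms] acim_def by (metis (no_types, lifting) image_cong image_image)
qed

text \<open>Closure under swap rebuilds the image from \<open>cim\<close>, \<open>acim\<close> and
  the swapped \<open>acim\<close>, so the image condition splits into two.\<close>

lemma im_eq_iff:
  assumes "tournament X \<omega>" "g \<in> binops X" "h \<in> binops X"
  shows "im X h = im X g \<longleftrightarrow> cim X h = cim X g \<and> acim X \<omega> h = acim X \<omega> g"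
proof -
  have "im X f = cim X f \<union> acim X \<omega> f \<union> prod.swap ` acim X \<omega> f" if "f \<in> binops X" for f
  proof
    show "cim X f \<union> acim X \<omega> f \<union> prod.swap ` acim X \<omega> f \<subseteq> im X f"
      unfolding acim_eq[OF assms(1) that] cim_def using im_swap by blast
    show "im X f \<subseteq> cim X f \<union> acim X \<omega> f \<union> prod.swap ` acim X \<omega> f"
    proof
      fix q assume q: "q \<in> im X f"
      then have "q \<in> Id_on X \<union> \<omega> \<union> prod.swap ` \<omega>"
        using im_subset[OF that] tournament_cover[OF assms(1)] by blast
      then show "q \<in> cim X f \<union> acim X \<omega> f \<union> prod.swap ` acim X \<omega> f"
        unfolding acim_eq[OF assms(1) that] cim_def using q im_swap[OF q] by force
    qed
  qed
  then show ?thesis using assms by (metis acim_eq cim_def)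
qed

text \<open>Swap fixes diagonal points, so the swapped part of the image contributes nothing
  new.\<close>

lemma cim_eq:
  assumes "tournament X \<omega>" "g \<in> binops X"
  shows "cim X g = diag X g \<union> (pairmorph g ` \<omega> \<inter> Id_on X)"
  unfolding cim_def im_eq[OF assms(1)] using diag_subset[OF assms(2)]
  by (auto simp: image_iff simp del: pairmorph_simp) (metis swap_simp)

text \<open>The restrictions to \<omega> of pairmorphs with diagonal image \<open>D\<close>,
  commutative image \<open>C\<close> and anticommutative image \<open>A\<close>; the conditions come
  from \<open>cim_eq\<close> and \<open>im_Int_tournament\<close>.\<close>

definition offdiagonal_maps :: "'a set \<Rightarrow> ('a \<times> 'a) set \<Rightarrow> ('a \<times> 'a) set \<Rightarrow> ('a \<times> 'a) set \<Rightarrow>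
    ('a \<times> 'a) set \<Rightarrow> ('a \<times> 'a \<Rightarrow> 'a \<times> 'a) set" where
  "offdiagonal_maps X \<omega> D C A = {v \<in> \<omega> \<rightarrow>\<^sub>E X \<times> X.
     D \<union> (v ` \<omega> \<inter> Id_on X) = C \<and> orient \<omega> ` (v ` \<omega> - Id_on X) = A}"

text \<open>Restriction and \<open>glue\<close> identify an operation with its diagonal and
  tournament data, and membership in the class constrains the two independently.\<close>

lemma card_L_class_product:
  assumes \<omega>: "tournament X \<omega>" and g: "g \<in> binops X" and "finite X"
  shows "card (L_class X g) = Surj (card X) (drank X g) *
    card (offdiagonal_maps X \<omega> (diag X g) (cim X g) (acim X \<omega> g))"
proof -
  define Y where "Y = (\<lambda>x. g (x, x)) ` X"
  let ?U = "{u \<in> X \<rightarrow>\<^sub>E Y. u ` X = Y}"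
  let ?V = "offdiagonal_maps X \<omega> (diag X g) (cim X g) (acim X \<omega> g)"
  let ?split = "\<lambda>h. (\<lambda>x\<in>X. h (x, x), restrict (pairmorph h) \<omega>)"
  have YX: "Y \<subseteq> X" using g by (auto simp: Y_def binops_mem)
  \<comment> \<open>Embedding points as diagonal pairs is injective, so \<open>diag\<close> can be
    compared inside \<open>X\<close>.\<close>
  have diagY: "diag X h = diag X g \<longleftrightarrow> (\<lambda>x. h (x, x)) ` X = Y" for h
    unfolding diag_eq Y_def by (rule inj_image_eq_iff) (simp add: inj_on_def)
  have L: "h \<in> L_class X g \<longleftrightarrow> h \<in> binops X \<and> ?split h \<in> ?U \<times> ?V" for h
  proof (cases "h \<in> binops X")
    case True
    have "restrict (pairmorph h) \<omega> \<in> \<omega> \<rightarrow>\<^sub>E X \<times> X"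
      using pairmorph_mem[OF True] tournament_subset[OF \<omega>] by auto
    then have V: "restrict (pairmorph h) \<omega> \<in> ?V \<longleftrightarrow> diag X g \<union> (pairmorph h ` \<omega> \<inter> Id_on X) = cim X g
        \<and> acim X \<omega> h = acim X \<omega> g"
      unfolding offdiagonal_maps_def acim_eq[OF \<omega> True] im_Int_tournament[OF \<omega> True]
      by simp
    have U: "(\<lambda>x\<in>X. h (x, x)) \<in> ?U \<longleftrightarrow> diag X h = diag X g"
      unfolding diagY by auto
    have "h \<in> L_class X g \<longleftrightarrow>
        diag X h = diag X g \<and> cim X h = cim X g \<and> acim X \<omega> h = acim X \<omega> g"
      by (simp add: L_class_eq[OF \<omega> g] im_eq_iff[OF \<omega> g True] True)
    \<comment> \<open>Replacing \<open>diag X h\<close> by the fixed \<open>diag X g\<close>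
      decouples the condition on \<omega> from the diagonal data.\<close>
    also have "\<dots> \<longleftrightarrow> diag X h = diag X g \<and>
        diag X g \<union> (pairmorph h ` \<omega> \<inter> Id_on X) = cim X g \<and> acim X \<omega> h = acim X \<omega> g"
      by (simp add: cim_eq[OF \<omega> True] cong: conj_cong)
    also have "\<dots> \<longleftrightarrow> h \<in> binops X \<and> ?split h \<in> ?U \<times> ?V"
      unfolding mem_Sigma_iff U V by (simp only: True simp_thms)
    finally show ?thesis .
  qed (simp add: L_class_eq[OF \<omega> g])
  have "bij_betw ?split (L_class X g) (?U \<times> ?V)"
  proof (rule bij_betw_byWitness[where f' = "\<lambda>(u, v). glue X \<omega> u v"])
    have sg: "glue X \<omega> u v \<in> binops X" "?split (glue X \<omega> u v) = (u, v)"
      if uv: "u \<in> ?U" "v \<in> ?V" for u v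
    proof -
      have "u \<in> X \<rightarrow>\<^sub>E X" "v \<in> \<omega> \<rightarrow>\<^sub>E X \<times> X"
        using uv YX by (auto simp: offdiagonal_maps_def PiE_iff)
      then show "glue X \<omega> u v \<in> binops X" "?split (glue X \<omega> u v) = (u, v)"
        using glue_in_binops[OF \<omega>] pairmorph_glue[OF \<omega>]
        by (auto simp: PiE_iff fun_eq_iff extensional_def glue_diagonal restrict_def
            simp del: pairmorph_simp)
    qed
    show "\<forall>h\<in>L_class X g. (\<lambda>(u, v). glue X \<omega> u v) (?split h) = h"
    proof
      fix h assume "h \<in> L_class X g"
      then have h: "h \<in> binops X" by (simp add: L)
      let ?h = "glue X \<omega> (\<lambda>x\<in>X. h (x, x)) (restrict (pairmorph h) \<omega>)"
      have "?h = h"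
      proof (rule binops_eqI[OF \<omega> _ h])
        show "?h \<in> binops X"
          using h pairmorph_mem[OF h] tournament_subset[OF \<omega>]
          by (intro glue_in_binops[OF \<omega>]) (auto simp: binops_mem)
      qed (simp_all only: glue_diagonal pairmorph_glue[OF \<omega>] restrict_apply if_True)
      then show "(\<lambda>(u, v). glue X \<omega> u v) (?split h) = h" by simp
    qed
    show "\<forall>uv\<in>?U \<times> ?V. ?split ((\<lambda>(u, v). glue X \<omega> u v) uv) = uv"
      using sg by auto
    show "?split ` L_class X g \<subseteq> ?U \<times> ?V" using L by blast
    show "(\<lambda>(u, v). glue X \<omega> u v) ` (?U \<times> ?V) \<subseteq> L_class X g"
    proof (rule image_subsetI)
      fix uv assume "uv \<in> ?U \<times> ?V"
      then obtain u v where uv: "uv = (u, v)" "u \<in> ?U" "v \<in> ?V" by blast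
      have "?split (glue X \<omega> u v) \<in> ?U \<times> ?V" unfolding sg(2)[OF uv(2,3)] using uv by blast
      then have "glue X \<omega> u v \<in> L_class X g" using L sg(1)[OF uv(2,3)] by blast
      then show "(\<lambda>(u, v). glue X \<omega> u v) uv \<in> L_class X g" by (simp add: uv(1))
    qed
  qed
  then have "card (L_class X g) = card (?U \<times> ?V)" by (rule bij_betw_same_card)
  moreover have "drank X g = card Y"
    unfolding drank_def diag_eq Y_def[symmetric] by (simp add: card_image inj_on_def)
  moreover have Y: "finite Y" using YX assms(3) finite_subset by blast
  ultimately show ?thesis
    unfolding card_cartesian_product using card_surjections[OF assms(3) Y] by simp
qed

text \<open>A map \<open>w\<close> amounts to the surjection
  \<open>orient \<omega> \<circ> w\<close> onto \<open>A\<close> and the subset of \<open>R\<close>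
  where its value lies in \<omega>; the free choice of that subset gives the power of 2.\<close>

lemma card_oriented_surjections:
  assumes \<omega>: "tournament X \<omega>" and A: "A \<subseteq> \<omega>" and fin: "finite R" "finite A"
  shows "card {w \<in> R \<rightarrow>\<^sub>E A \<union> prod.swap ` A. orient \<omega> ` w ` R = A} =
    Surj (card R) (card A) * 2 ^ card R"
proof -
  let ?W = "{w \<in> R \<rightarrow>\<^sub>E A \<union> prod.swap ` A. orient \<omega> ` w ` R = A}"
  let ?F = "{f \<in> R \<rightarrow>\<^sub>E A. f ` R = A}"
  let ?split = "\<lambda>w. (\<lambda>p\<in>R. orient \<omega> (w p), {p \<in> R. w p \<in> \<omega>})"
  let ?join = "\<lambda>(f, Q). \<lambda>p\<in>R. if p \<in> Q then f p else prod.swap (f p)"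
  \<comment> \<open>Both \<open>q\<close> and its swap orient to \<open>q\<close>, and membership in
    \<omega> tells them apart; hence the splitting can be inverted.\<close>
  have or: "orient \<omega> q = q" "orient \<omega> (prod.swap q) = q" "prod.swap q \<notin> \<omega>" "q \<in> \<omega>" if "q \<in> A" for q
    using that A swap_notin_tournament[OF \<omega>, of q] by (auto simp: orient_def)
  have "bij_betw ?split ?W (?F \<times> Pow R)"
  proof (rule bij_betw_byWitness[where f' = ?join])
    show "\<forall>w\<in>?W. ?join (?split w) = w"
      by (auto simp: fun_eq_iff PiE_iff extensional_def orient_def)
    have FQ: "?split (?join fQ) = fQ \<and> ?join fQ \<in> ?W" if FQ_mem: "fQ \<in> ?F \<times> Pow R" for fQ
    proof -
      obtain f Q where fQ: "fQ = (f, Q)" and f: "f \<in> R \<rightarrow>\<^sub>E A" "f ` R = A" and Q: "Q \<subseteq> R"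
        using FQ_mem by blast
      let ?w = "?join (f, Q)"
      have fA: "f p \<in> A" if "p \<in> R" for p using f(1) that by (rule PiE_mem)
      have or_w: "orient \<omega> (?w p) = f p" if "p \<in> R" for p
        using or[OF fA[OF that]] that by simp
      have "(\<lambda>p\<in>R. orient \<omega> (?w p)) = f"
      proof
        show "(\<lambda>p\<in>R. orient \<omega> (?w p)) p = f p" for p
          using or_w[of p] PiE_arb[OF f(1), of p] by (cases "p \<in> R") simp_all
      qed
      moreover have "{p \<in> R. ?w p \<in> \<omega>} = Q" using or fA Q by auto
      moreover have "orient \<omega> ` ?w ` R = A"
        unfolding image_image f(2)[symmetric] by (rule image_cong[OF refl or_w])
      moreover have "?w \<in> R \<rightarrow>\<^sub>E A \<union> prod.swap ` A" using fA by auto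
      ultimately show ?thesis unfolding fQ by blast
    qed
    then show "\<forall>fQ\<in>?F \<times> Pow R. ?split (?join fQ) = fQ" "?join ` (?F \<times> Pow R) \<subseteq> ?W" by blast+
    show "?split ` ?W \<subseteq> ?F \<times> Pow R"
    proof (intro image_subsetI SigmaI CollectI conjI)
      fix w assume "w \<in> ?W"
      then have w: "w \<in> R \<rightarrow>\<^sub>E A \<union> prod.swap ` A" "orient \<omega> ` w ` R = A" by auto
      then show "(\<lambda>p\<in>R. orient \<omega> (w p)) ` R = A" by (simp add: image_image)
      show "(\<lambda>p\<in>R. orient \<omega> (w p)) \<in> R \<rightarrow>\<^sub>E A" using w(2) by auto
    qed auto
  qed
  then have "card ?W = card (?F \<times> Pow R)" by (rule bij_betw_same_card)
  then show ?thesis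
    unfolding card_cartesian_product card_surjections[OF fin] card_Pow[OF fin(1)] .
qed

text \<open>Once the locus \<open>R\<close> of off-diagonal values is fixed, the condition on
  \<open>A\<close> concerns only the values on \<open>R\<close> and the condition on
  \<open>C\<close> only those on \<open>\<omega> - R\<close>.\<close>

lemma card_offdiagonal_maps_fiber:
  assumes \<omega>: "tournament X \<omega>" and A: "A \<subseteq> \<omega>" and C: "C \<subseteq> Id_on X" and D: "D \<subseteq> C" and R: "R \<subseteq> \<omega>"
  shows "card {v \<in> offdiagonal_maps X \<omega> D C A. {p \<in> \<omega>. v p \<notin> Id_on X} = R} =
    card {w \<in> R \<rightarrow>\<^sub>E A \<union> prod.swap ` A. orient \<omega> ` w ` R = A} *
    card {t \<in> \<omega> - R \<rightarrow>\<^sub>E C. C - D \<subseteq> t ` (\<omega> - R)}"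
proof -
  let ?V = "{v \<in> offdiagonal_maps X \<omega> D C A. {p \<in> \<omega>. v p \<notin> Id_on X} = R}"
  let ?W = "{w \<in> R \<rightarrow>\<^sub>E A \<union> prod.swap ` A. orient \<omega> ` w ` R = A}"
  let ?T = "{t \<in> \<omega> - R \<rightarrow>\<^sub>E C. C - D \<subseteq> t ` (\<omega> - R)}"
  let ?split = "\<lambda>v. (restrict v R, restrict v (\<omega> - R))"
  let ?join = "\<lambda>(w, t). \<lambda>p\<in>\<omega>. if p \<in> R then w p else t p"
  \<comment> \<open>Values in \<open>A\<close> or its swap are off the diagonal and those in
    \<open>C\<close> on it, so a joined map has off-diagonal locus exactly \<open>R\<close>.\<close>
  have AX: "A \<union> prod.swap ` A \<subseteq> X \<times> X - Id_on X" "C \<subseteq> X \<times> X"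
    using A C \<omega> by (auto simp: tournament_def)
  have "bij_betw ?split ?V (?W \<times> ?T)"
  proof (rule bij_betw_byWitness[where f' = ?join])
    show "\<forall>v\<in>?V. ?join (?split v) = v"
      by (auto simp: fun_eq_iff offdiagonal_maps_def PiE_iff extensional_def)
    show "\<forall>wt\<in>?W \<times> ?T. ?split (?join wt) = wt"
    proof
      fix wt assume "wt \<in> ?W \<times> ?T"
      then obtain w t where wt: "wt = (w, t)"
        and w: "w \<in> R \<rightarrow>\<^sub>E A \<union> prod.swap ` A" and t: "t \<in> \<omega> - R \<rightarrow>\<^sub>E C" by blast
      have "restrict (?join (w, t)) R p = w p" for p
        using R PiE_arb[OF w, of p] by (cases "p \<in> R") auto
      moreover have "restrict (?join (w, t)) (\<omega> - R) p = t p" for p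
        using PiE_arb[OF t, of p] by (cases "p \<in> \<omega> - R") auto
      ultimately show "?split (?join wt) = wt" unfolding wt by (simp add: fun_eq_iff)
    qed
    show "?split ` ?V \<subseteq> ?W \<times> ?T"
    proof (intro image_subsetI)
      fix v assume "v \<in> ?V"
      then have v: "v \<in> \<omega> \<rightarrow>\<^sub>E X \<times> X" "D \<union> (v ` \<omega> \<inter> Id_on X) = C"
        "orient \<omega> ` (v ` \<omega> - Id_on X) = A" and Rv: "{p \<in> \<omega>. v p \<notin> Id_on X} = R"
        by (auto simp: offdiagonal_maps_def)
      have imR: "v ` \<omega> - Id_on X = v ` R" "v ` \<omega> \<inter> Id_on X = v ` (\<omega> - R)"
        unfolding image_Diff_eq image_Int_eq Rv by (rule refl)+
      have "v p \<in> A \<union> prod.swap ` A" if "p \<in> R" for p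
      proof -
        have "orient \<omega> (v p) \<in> A" using v(3) imR that by blast
        then show ?thesis by (force simp: orient_def split: if_splits)
      qed
      then have "restrict v R \<in> ?W" using v(3) imR by auto
      moreover have "restrict v (\<omega> - R) \<in> ?T" using v(2) imR by auto
      ultimately show "?split v \<in> ?W \<times> ?T" by simp
    qed
    show "?join ` (?W \<times> ?T) \<subseteq> ?V"
    proof (intro image_subsetI)
      fix wt assume "wt \<in> ?W \<times> ?T"
      then obtain w t where wt: "wt = (w, t)"
        and w: "w \<in> R \<rightarrow>\<^sub>E A \<union> prod.swap ` A" "orient \<omega> ` w ` R = A"
        and t: "t \<in> \<omega> - R \<rightarrow>\<^sub>E C" "C - D \<subseteq> t ` (\<omega> - R)" by auto
      let ?v = "?join (w, t)"
      have wR: "w p \<in> X \<times> X - Id_on X" if "p \<in> R" for p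
        using AX(1) PiE_mem[OF w(1) that] by (rule subsetD)
      have tR: "t p \<in> C" if "p \<in> \<omega> - R" for p
        using t(1) that by (rule PiE_mem)
      have "?v \<in> \<omega> \<rightarrow>\<^sub>E X \<times> X" using wR subsetD[OF AX(2) tR] by auto
      moreover have Rv: "{p \<in> \<omega>. ?v p \<notin> Id_on X} = R"
        using wR subsetD[OF C tR] R by auto
      moreover have "?v ` \<omega> - Id_on X = ?v ` R" "?v ` \<omega> \<inter> Id_on X = ?v ` (\<omega> - R)"
        unfolding image_Diff_eq image_Int_eq Rv by (rule refl)+
      moreover have "?v ` R = w ` R" "?v ` (\<omega> - R) = t ` (\<omega> - R)"
        using R by (auto simp: image_def)
      \<comment> \<open>The diagonal already supplies \<open>D\<close>, so \<open>t\<close> has to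
        cover only \<open>C - D\<close>.\<close>
      moreover have "D \<union> t ` (\<omega> - R) = C" using t(2) tR D by blast
      ultimately show "?join wt \<in> ?V" using w(2) unfolding wt offdiagonal_maps_def by simp
    qed
  qed
  then have "card ?V = card (?W \<times> ?T)" by (rule bij_betw_same_card)
  then show ?thesis unfolding card_cartesian_product .
qed

text \<open>The maps are partitioned by their off-diagonal locus \<open>R\<close>, and the size of
  each fiber depends only on \<open>card R\<close>.\<close>

lemma card_offdiagonal_maps:
  assumes \<omega>: "tournament X \<omega>" and A: "A \<subseteq> \<omega>" and C: "C \<subseteq> Id_on X" and D: "D \<subseteq> C" and X: "finite X"
  shows "int (card (offdiagonal_maps X \<omega> D C A)) =
    (\<Sum>r\<le>card \<omega>. int (card \<omega> choose r) * (int (Surj r (card A)) * 2 ^ r *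
      (\<Sum>k\<le>card C - card D. (- 1) ^ k * int ((card C - card D) choose k) *
        (int (card C) - int k) ^ (card \<omega> - r))))"
proof -
  have fin: "finite \<omega>" "finite A" "finite C"
    using X A C tournament_subset[OF \<omega>] finite_subset[of _ "X \<times> X"] finite_subset[of _ "Id_on X"]
      finite_subset[of A \<omega>] by (auto simp: Id_on_def)
  let ?V = "offdiagonal_maps X \<omega> D C A"
  let ?\<phi> = "\<lambda>r. int (Surj r (card A)) * 2 ^ r *
    (\<Sum>k\<le>card C - card D. (- 1) ^ k * int ((card C - card D) choose k) *
      (int (card C) - int k) ^ (card \<omega> - r))"
  have finV: "finite ?V" unfolding offdiagonal_maps_def using fin X by (simp add: finite_PiE)
  \<comment> \<open>Summing the constant 1 over the fibers of the map sending \<open>v\<close> to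
    its off-diagonal locus.\<close>
  have "card ?V = (\<Sum>R\<in>Pow \<omega>. card {v \<in> ?V. {p \<in> \<omega>. v p \<notin> Id_on X} = R})"
    using sum.group[of ?V "Pow \<omega>" "\<lambda>v. {p \<in> \<omega>. v p \<notin> Id_on X}" "\<lambda>_. 1::nat"] finV fin
    by (simp add: image_subset_iff)
  then have "int (card ?V) = (\<Sum>R\<in>Pow \<omega>. int (card {v \<in> ?V. {p \<in> \<omega>. v p \<notin> Id_on X} = R}))"
    by simp
  also have "\<dots> = (\<Sum>R\<in>Pow \<omega>. ?\<phi> (card R))"
  proof (rule sum.cong)
    fix R assume "R \<in> Pow \<omega>"
    then have R: "R \<subseteq> \<omega>" "finite R" using fin finite_subset by auto
    have "card (C - D) = card C - card D" "card (\<omega> - R) = card \<omega> - card R"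
      using D R fin by (auto intro!: card_Diff_subset intro: finite_subset)
    then show "int (card {v \<in> ?V. {p \<in> \<omega>. v p \<notin> Id_on X} = R}) =
      ?\<phi> (card R)"
      using card_offdiagonal_maps_fiber[OF \<omega> A C D R(1)] card_oriented_surjections[OF \<omega> A R(2) fin(2)]
        card_functions_covering[of "\<omega> - R" C "C - D"] fin by simp
  qed simp
  finally show ?thesis unfolding sum_Pow_card[OF fin(1), of ?\<phi>] .
qed

section \<open>Assembling the cardinality formula\<close>

theorem theorem8:
  fixes X :: "'a set" and \<omega> :: "('a \<times> 'a) set" and star :: "'a \<times> 'a \<Rightarrow> 'a"
    and n N d c a :: nat
  assumes "finite X" and "card X = n" and "N = n choose 2"
    and "tournament X \<omega>"
    and "star \<in> binops X"
    and "drank X star = d" and "crank X star = c" and "arank X \<omega> star = a"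
  shows "int (card (L_class X star)) =
    int (Surj n d) *
      (\<Sum>r = a..N + d - c. int (N choose r) * int (Surj r a) * 2 ^ r *
        (int c ^ (N - r) +
          (\<Sum>k = 1..c - d. (- 1) ^ k * int ((c - d) choose k) * (int c - int k) ^ (N - r))))"
proof -
  let ?S = "\<lambda>r. \<Sum>k\<le>c - d. (- 1) ^ k * int ((c - d) choose k) * (int c - int k) ^ (N - r)"
  let ?t = "\<lambda>r. int (N choose r) * int (Surj r a) * 2 ^ r * ?S r"
  have \<omega>: "tournament X \<omega>" and g: "star \<in> binops X" by fact+
  have N: "card \<omega> = N" using card_tournament[OF assms(1) \<omega>] assms(2,3) by simp
  have sub: "acim X \<omega> star \<subseteq> \<omega>" "cim X star \<subseteq> Id_on X" "diag X star \<subseteq> cim X star"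
    unfolding acim_eq[OF \<omega> g] cim_eq[OF \<omega> g] using diag_subset[OF g] by auto
  have ranks: "card (diag X star) = d" "card (cim X star) = c" "card (acim X \<omega> star) = a"
    using assms(6-8) by (auto simp: drank_def crank_def arank_def)
  have "finite (cim X star)" using assms(1) by (simp add: cim_def im_def)
  \<comment> \<open>This makes \<open>c - d\<close> a genuine difference and keeps
    \<open>N + d - c\<close> at most \<open>N\<close>.\<close>
  then have dc: "d \<le> c" using card_mono[OF _ sub(3)] ranks by simp
  \<comment> \<open>The term k = 0 is split off to match the stated form.\<close>
  have S: "?S r = int c ^ (N - r) +
      (\<Sum>k = 1..c - d. (- 1) ^ k * int ((c - d) choose k) * (int c - int k) ^ (N - r))" for r
    by (simp add: atMost_atLeast0 sum.atLeast_Suc_atMost)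
  have "int (card (L_class X star)) = int (Surj n d) * (\<Sum>r\<le>N. ?t r)"
    using card_L_class_product[OF \<omega> g assms(1)] card_offdiagonal_maps[OF \<omega> sub assms(1)]
    by (simp add: ranks N assms(2,6) mult.assoc)
  also have "(\<Sum>r\<le>N. ?t r) = (\<Sum>r = a..N + d - c. ?t r)"
  proof (rule sum.mono_neutral_right)
    show "\<forall>r\<in>{..N} - {a..N + d - c}. ?t r = 0"
    proof
      fix r assume r: "r \<in> {..N} - {a..N + d - c}"
      \<comment> \<open>Below the range, \<open>r\<close> pairs cannot map onto \<open>a\<close>
        values; above it, the remaining \<open>N - r\<close> pairs are too few to cover the
        \<open>c - d\<close> points outside the diagonal image.\<close>
      then consider "r < a" | "N - r < c - d" using dc by force
      then show "?t r = 0"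
        using Surj_eq_0[of r a] alternating_binomial_sum_eq_0[of "N - r" "c - d" c] by cases auto
    qed
  qed (use dc in auto)
  finally show ?thesis unfolding S .
qed

end
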